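(* Assume $c\ge 1$, $n$ is large enough and $\gamma\le 1/4$. Any (possibly randomized) algorithm in the noisy model with parameter $\gamma$ with query complexity $\frac{cn}{\gamma^2}$ solves FINDMIN on $n$ elements with probability at most $1-e^{-O(c)}$.
   Context: Setting. The input is a set of $n$ elements with an unknown total order, presented in uniformly random order (the elements are a priori indistinguishable). FINDMIN: output the minimum element. Algorithms access the order only through pairwise comparison queries, which may be made adaptively in any number of rounds and with repetition (resampling). Query complexity is the total number of comparisons. Noisy model with parameter $\gamma$: each comparison independently returns the correct answer with probability $1/2+\gamma/2$ and the incorrect answer with probability $1/2-\gamma/2$. The success probability is over the random input order, the comparison outcomes and the algorithm's randomness. *)

theory Defs
  imports "HOL-Probability.Probability" "HOL-Combinatorics.Permutations"
begin

text \<open>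
  The elements are \<open>0, \<dots>, n - 1\<close> and the unknown order is a permutation \<open>p\<close> of \<open>{..<n}\<close>:
  element \<open>x\<close> has rank \<open>p x\<close>, so \<open>x\<close> is below \<open>y\<close> iff \<open>p x < p y\<close>. A uniformly random input
  order is a uniformly random such \<open>p\<close>.
\<close>

definition random_order :: "nat \<Rightarrow> (nat \<Rightarrow> nat) pmf" where
  "random_order n = pmf_of_set {p. p permutes {..<n}}"

definition is_minimum :: "nat \<Rightarrow> (nat \<Rightarrow> nat) \<Rightarrow> nat \<Rightarrow> bool" where
  "is_minimum n p x \<longleftrightarrow> x < n \<and> (\<forall>y<n. p x \<le> p y)"

text \<open>
  A deterministic adaptive algorithm is a decision tree. \<open>Query x y t u\<close> asks whether \<open>x\<close> is
  below \<open>y\<close> and continues with \<open>t\<close> on a positive and with \<open>u\<close> on a negative answer. The same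
  pair may be queried repeatedly along a branch.
\<close>

datatype algorithm = Output nat | Query nat nat algorithm algorithm

primrec queries_valid :: "nat \<Rightarrow> algorithm \<Rightarrow> bool" where
  "queries_valid n (Output x) \<longleftrightarrow> x < n"
| "queries_valid n (Query x y t u) \<longleftrightarrow>
     x < n \<and> y < n \<and> x \<noteq> y \<and> queries_valid n t \<and> queries_valid n u"

primrec query_complexity :: "algorithm \<Rightarrow> nat" where
  "query_complexity (Output x) = 0"
| "query_complexity (Query x y t u) = Suc (max (query_complexity t) (query_complexity u))"

definition noisy_comparison :: "real \<Rightarrow> (nat \<Rightarrow> nat) \<Rightarrow> nat \<Rightarrow> nat \<Rightarrow> bool pmf" where
  "noisy_comparison \<gamma> p x y =
     map_pmf (\<lambda>correct. if correct then p x < p y else \<not> p x < p y)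
       (bernoulli_pmf (1 / 2 + \<gamma> / 2))"

text \<open>Every visited query node draws fresh, independent noise.\<close>

primrec run :: "real \<Rightarrow> (nat \<Rightarrow> nat) \<Rightarrow> algorithm \<Rightarrow> nat pmf" where
  "run \<gamma> p (Output x) = return_pmf x"
| "run \<gamma> p (Query x y t u) =
     bind_pmf (noisy_comparison \<gamma> p x y) (\<lambda>b. if b then run \<gamma> p t else run \<gamma> p u)"

text \<open>
  A randomized algorithm is a distribution over decision trees (all coins are drawn in advance,
  independently of the input order and of the noise). Since \<open>algorithm\<close> is a countable type,
  discrete distributions cover every source of internal randomness.
\<close>

definition findmin_success :: "nat \<Rightarrow> real \<Rightarrow> algorithm pmf \<Rightarrow> real" where
  "findmin_success n \<gamma> A =
     measure_pmf.prob
       (bind_pmf (random_order n) (\<lambda>p.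
        bind_pmf A (\<lambda>t.
        bind_pmf (run \<gamma> p t) (\<lambda>x. return_pmf (p, x)))))
       {(p, x). is_minimum n p x}"

definition query_bounded :: "nat \<Rightarrow> real \<Rightarrow> algorithm pmf \<Rightarrow> bool" where
  "query_bounded n q A \<longleftrightarrow>
     (\<forall>t\<in>set_pmf A. queries_valid n t \<and> real (query_complexity t) \<le> q)"

end

theory Submission
  imports Defs
begin

text \<open>
  Moving an element \<open>x\<close> of a random order \<open>p\<close> to the front yields again a random order \<open>p'\<close>, and
  only the comparisons involving \<open>x\<close> can tell \<open>p\<close> from \<open>p'\<close>. On average over \<open>x\<close> there are
  \<open>O(c / \<gamma>\<^sup>2)\<close> of them, each contributing \<open>O(\<gamma>\<^sup>2)\<close> to the logarithm of the affinity between the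
  two runs. As \<open>p\<close> and \<open>p'\<close> have different minima, this bounds the sum of the two failure
  probabilities from below by \<open>exp (- O(c))\<close>.
\<close>

section \<open>Noisy runs of a fixed decision tree\<close>

lemma measure_bind_pmf:
  "measure_pmf.prob (bind_pmf M f) X = measure_pmf.expectation M (\<lambda>x. measure_pmf.prob (f x) X)"
proof -
  have "ennreal (measure_pmf.prob (bind_pmf M f) X)
      = (\<integral>\<^sup>+x. ennreal (measure_pmf.prob (f x) X) \<partial>M)"
    by (simp flip: measure_pmf.emeasure_eq_measure)
  also have "\<dots> = ennreal (measure_pmf.expectation M (\<lambda>x. measure_pmf.prob (f x) X))"
    by (intro nn_integral_eq_integral measure_pmf.integrable_const_bound[where B = 1]) auto
  finally show ?thesis
    by simp
qed

definition answer_prob :: "real \<Rightarrow> (nat \<Rightarrow> nat) \<Rightarrow> nat \<Rightarrow> nat \<Rightarrow> real" where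
  "answer_prob \<gamma> p x y = (if p x < p y then 1 / 2 + \<gamma> / 2 else 1 / 2 - \<gamma> / 2)"

lemma answer_prob_bounds:
  assumes "0 < \<gamma>" "\<gamma> < 1"
  shows "0 < answer_prob \<gamma> p x y" "answer_prob \<gamma> p x y < 1"
  using assms by (auto simp: answer_prob_def)

lemma prob_run_Query:
  assumes "0 < \<gamma>" "\<gamma> < 1"
  shows "measure_pmf.prob (run \<gamma> p (Query x y t u)) S =
    answer_prob \<gamma> p x y * measure_pmf.prob (run \<gamma> p t) S +
    (1 - answer_prob \<gamma> p x y) * measure_pmf.prob (run \<gamma> p u) S"
  using assms
  by (simp add: measure_bind_pmf noisy_comparison_def integral_map_pmf answer_prob_def field_simps)

text \<open>The expectation is over the noise of a run under the single order \<open>p\<close>. When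
  two orders are compared below, the second one never enters this count, so one bound on the count
  under \<open>p\<close> serves all modified orders at once.\<close>

primrec expected_queries :: "real \<Rightarrow> (nat \<Rightarrow> nat) \<Rightarrow> algorithm \<Rightarrow> nat \<Rightarrow> real" where
  "expected_queries \<gamma> p (Output z) x = 0"
| "expected_queries \<gamma> p (Query a b t u) x = of_bool (x = a \<or> x = b) +
     answer_prob \<gamma> p a b * expected_queries \<gamma> p t x +
     (1 - answer_prob \<gamma> p a b) * expected_queries \<gamma> p u x"

text \<open>A comparison involves two elements, so each level of the tree adds at most 2 to the sum
  over all elements.\<close>

lemma sum_expected_queries_le:
  assumes "0 < \<gamma>" "\<gamma> < 1" and "finite X"
  shows "(\<Sum>x\<in>X. expected_queries \<gamma> p t x) \<le> 2 * real (query_complexity t)"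
proof (induction t)
  case (Query a b t u)
  let ?q = "answer_prob \<gamma> p a b"
  let ?m = "real (max (query_complexity t) (query_complexity u))"
  note q = answer_prob_bounds[OF assms(1,2), of p a b]
  have "(\<Sum>x\<in>X. of_bool (x = a \<or> x = b)) = real (card (X \<inter> {a, b}))"
    using assms(3) by (simp add: of_bool_def sum.If_cases Int_def)
  also have "\<dots> \<le> 2"
    using card_mono[of "{a, b}" "X \<inter> {a, b}"] card_insert_le_m1[of 2 "{b}" a] by simp
  finally have 1: "(\<Sum>x\<in>X. of_bool (x = a \<or> x = b)) \<le> (2::real)" .
  have "?q * (\<Sum>x\<in>X. expected_queries \<gamma> p t x) \<le> ?q * (2 * ?m)"
    using q Query.IH(1) by (intro mult_left_mono) auto
  moreover have "(1 - ?q) * (\<Sum>x\<in>X. expected_queries \<gamma> p u x) \<le> (1 - ?q) * (2 * ?m)"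
    using q Query.IH(2) by (intro mult_left_mono) auto
  moreover have "?q * (2 * ?m) + (1 - ?q) * (2 * ?m) = 2 * ?m"
    by (simp add: algebra_simps)
  ultimately show ?case
    using 1 by (simp add: sum.distrib flip: sum_distrib_left)
qed simp

section \<open>Convexity estimates for a single comparison\<close>

lemma exp_tangent_le:
  fixes m z :: real
  shows "exp m * (1 + (z - m)) \<le> exp z"
  using mult_left_mono[OF exp_ge_add_one_self[of "z - m"], of "exp m"] by (simp flip: exp_add)

lemma exp_convex_combination:
  fixes q x y :: real
  assumes "0 \<le> q" "q \<le> 1"
  shows "exp (q * x + (1 - q) * y) \<le> q * exp x + (1 - q) * exp y"
proof -
  let ?m = "q * x + (1 - q) * y"
  \<comment> \<open>Jensen's inequality through the tangent at the mean \<open>?m\<close>: the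
    linear corrections cancel because \<open>q * (x - ?m) + (1 - q) * (y - ?m) = 0\<close>.\<close>
  have "exp ?m = q * (exp ?m * (1 + (x - ?m))) + (1 - q) * (exp ?m * (1 + (y - ?m)))"
    by algebra
  also have "\<dots> \<le> q * exp x + (1 - q) * exp y"
    using assms by (intro add_mono mult_left_mono exp_tangent_le) auto
  finally show ?thesis .
qed

lemma ln_odds_le:
  fixes g :: real
  assumes "0 < g" "g \<le> 1 / 4"
  shows "ln ((1 + g) / (1 - g)) \<le> 4 * g"
proof -
  have "ln ((1 + g) / (1 - g)) \<le> (1 + g) / (1 - g) - 1"
    using assms by (intro ln_le_minus_one) auto
  also have "\<dots> \<le> 4 * g"
    using assms by (simp add: field_simps)
  finally show ?thesis .
qed

text \<open>This is the induction step at a node whose answer law differs under the two orders: the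
  second law gives \<open>1 - q\<close> where the first gives \<open>q\<close>, so both branches
  carry the weight \<open>sqrt (q * (1 - q))\<close>. Rewriting this weight as
  \<open>q * exp l\<close> and \<open>(1 - q) * exp (- l)\<close> turns the right side into an
  average with weights \<open>q\<close> and \<open>1 - q\<close>, to which Jensen's inequality
  applies. The loss is the mean of \<open>l\<close> and \<open>- l\<close>, which is of order
  \<open>\<gamma>\<^sup>2\<close>.\<close>

lemma affinity_flipped_answer:
  assumes "0 < \<gamma>" "\<gamma> \<le> 1 / 4" and q: "q = 1 / 2 + \<gamma> / 2 \<or> q = 1 / 2 - \<gamma> / 2"
  shows "exp (- 2 * \<gamma>\<^sup>2 - (q * x + (1 - q) * y)) \<le> sqrt (q * (1 - q)) * (exp (- x) + exp (- y))"
proof -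
  \<comment> \<open>Half the log-odds, the solution of
    \<open>q * exp l = (1 - q) * exp (- l)\<close>.\<close>
  define l where "l = ln ((1 - q) / q) / 2"
  have q01: "0 < q" "q < 1"
    using assms by auto
  have half: "exp (ln z / 2) = sqrt z" if "0 < z" for z :: real
    using that by (intro real_sqrt_unique[symmetric]) (simp_all add: power2_eq_square flip: exp_add)
  have l: "exp l = sqrt ((1 - q) / q)"
    unfolding l_def using q01 by (intro half) simp
  have q_sq: "sqrt q * sqrt q = q" and q'_sq: "sqrt (1 - q) * sqrt (1 - q) = 1 - q"
    using q01 by auto
  have "q * (sqrt (1 - q) / sqrt q) = sqrt q * sqrt q * (sqrt (1 - q) / sqrt q)"
    by (simp only: q_sq)
  then have ql: "q * exp l = sqrt (q * (1 - q))"
    using q01 by (simp add: l real_sqrt_divide real_sqrt_mult del: real_sqrt_mult_self)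
  have "(1 - q) * (sqrt q / sqrt (1 - q)) = sqrt (1 - q) * sqrt (1 - q) * (sqrt q / sqrt (1 - q))"
    by (simp only: q'_sq)
  then have q'l: "(1 - q) * exp (- l) = sqrt (q * (1 - q))"
    using q01 by (simp add: l exp_minus real_sqrt_divide real_sqrt_mult del: real_sqrt_mult_self)
  \<comment> \<open>The right side is \<open>q * l + (1 - q) * (- l)\<close>. Both possible values
    of \<open>q\<close> give the same number, since exchanging \<open>q\<close> and
    \<open>1 - q\<close> changes the sign of both factors.\<close>
  have "- 2 * \<gamma>\<^sup>2 \<le> (2 * q - 1) * l"
  proof -
    have "(2 * q - 1) * l = - (\<gamma> * ln ((1 + \<gamma>) / (1 - \<gamma>))) / 2"
      using q
    proof
      assume *: "q = 1 / 2 + \<gamma> / 2"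
      then have "(1 - q) / q = (1 - \<gamma>) / (1 + \<gamma>)"
        using assms(1,2) by (simp add: field_simps)
      then show ?thesis
        using assms(1,2) * by (simp add: l_def ln_div algebra_simps)
    next
      assume *: "q = 1 / 2 - \<gamma> / 2"
      then have "(1 - q) / q = (1 + \<gamma>) / (1 - \<gamma>)"
        using assms(1,2) by (simp add: field_simps)
      then show ?thesis
        using * by (simp add: l_def)
    qed
    moreover have "\<gamma> * ln ((1 + \<gamma>) / (1 - \<gamma>)) \<le> \<gamma> * (4 * \<gamma>)"
      using ln_odds_le[OF assms(1,2)] assms(1) by (intro mult_left_mono) auto
    ultimately show ?thesis
      by (simp add: power2_eq_square)
  qed
  then have "exp (- 2 * \<gamma>\<^sup>2 - (q * x + (1 - q) * y)) \<le> exp (q * (l - x) + (1 - q) * (- l - y))"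
    by (simp add: algebra_simps)
  also have "\<dots> \<le> q * exp (l - x) + (1 - q) * exp (- l - y)"
    using q01 by (intro exp_convex_combination) auto
  also have "\<dots> = (q * exp l) * exp (- x) + ((1 - q) * exp (- l)) * exp (- y)"
    by (simp add: exp_diff exp_minus field_simps)
  also have "\<dots> = sqrt (q * (1 - q)) * (exp (- x) + exp (- y))"
    unfolding ql q'l by (simp add: algebra_simps)
  finally show ?thesis .
qed

section \<open>Affinity of the outputs under two orders\<close>

lemma sqrt_mult_add_le:
  fixes a b c d :: real
  assumes "0 \<le> a" "0 \<le> b" "0 \<le> c" "0 \<le> d"
  shows "sqrt (a * c) + sqrt (b * d) \<le> sqrt ((a + b) * (c + d))"
proof (rule real_le_rsqrt)
  have "0 \<le> (sqrt (a * d) - sqrt (b * c))\<^sup>2"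
    by simp
  then have "2 * (sqrt (a * d) * sqrt (b * c)) \<le> a * d + b * c"
    using assms by (simp add: power2_diff)
  moreover have "sqrt (a * d) * sqrt (b * c) = sqrt (a * c) * sqrt (b * d)"
    by (simp add: real_sqrt_mult)
  ultimately show "(sqrt (a * c) + sqrt (b * d))\<^sup>2 \<le> (a + b) * (c + d)"
    using assms by (simp add: power2_sum algebra_simps)
qed

text \<open>The Bhattacharyya coefficient of the two laws after coarsening the outcome to membership
  in \<open>S\<close>. Two-point laws suffice because only one event, a correct answer for the first
  order, has to be tested.\<close>

definition affinity :: "'a set \<Rightarrow> 'a pmf \<Rightarrow> 'a pmf \<Rightarrow> real" where
  "affinity S P Q = sqrt (measure_pmf.prob P S * measure_pmf.prob Q S) +
     sqrt (measure_pmf.prob P (- S) * measure_pmf.prob Q (- S))"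

lemma affinity_refl: "affinity S P P = 1"
  by (simp add: affinity_def measure_pmf.prob_compl[where 'a = 'a, of S, simplified]
      Compl_eq_Diff_UNIV flip: power2_eq_square)

text \<open>At a query each run is a mixture of the runs of its subtrees, and the Cauchy-Schwarz
  inequality \<open>sqrt_mult_add_le\<close> applies to \<open>S\<close> and to \<open>- S\<close>
  separately.\<close>

lemma affinity_run_Query:
  fixes p p' :: "nat \<Rightarrow> nat" and x y :: nat
  assumes "0 < \<gamma>" "\<gamma> < 1"
  defines "q \<equiv> answer_prob \<gamma> p x y" and "q' \<equiv> answer_prob \<gamma> p' x y"
  shows "sqrt (q * q') * affinity S (run \<gamma> p t) (run \<gamma> p' t) +
      sqrt ((1 - q) * (1 - q')) * affinity S (run \<gamma> p u) (run \<gamma> p' u)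
    \<le> affinity S (run \<gamma> p (Query x y t u)) (run \<gamma> p' (Query x y t u))"
proof -
  let ?P = "\<lambda>t T. measure_pmf.prob (run \<gamma> p t) T" and ?Q = "\<lambda>t T. measure_pmf.prob (run \<gamma> p' t) T"
  have q: "0 < q" "q < 1" "0 < q'" "q' < 1"
    unfolding q_def q'_def using answer_prob_bounds[OF assms(1,2)] by auto
  have "sqrt (q * q') * sqrt (?P t T * ?Q t T) + sqrt ((1 - q) * (1 - q')) * sqrt (?P u T * ?Q u T)
      \<le> sqrt (?P (Query x y t u) T * ?Q (Query x y t u) T)" for T
    using sqrt_mult_add_le[of "q * ?P t T" "(1 - q) * ?P u T" "q' * ?Q t T" "(1 - q') * ?Q u T"] q
    unfolding prob_run_Query[OF assms(1,2)] q_def[symmetric] q'_def[symmetric]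
    by (simp add: real_sqrt_mult mult_ac)
  from add_mono[OF this[of S] this[of "- S"]] show ?thesis
    by (simp add: affinity_def algebra_simps)
qed

text \<open>Induction on the tree. Only a comparison involving \<open>x\<close> can have different
  answer laws under the two orders, and each such comparison costs at most
  \<open>2 * \<gamma>\<^sup>2\<close> in the exponent. Jensen's inequality keeps the expected number
  of these comparisons in the exponent.\<close>

lemma affinity_run_ge:
  assumes \<gamma>: "0 < \<gamma>" "\<gamma> \<le> 1 / 4"
    and same: "\<And>a b. a \<noteq> x \<Longrightarrow> b \<noteq> x \<Longrightarrow> p a < p b \<longleftrightarrow> p' a < p' b"
  shows "exp (- 2 * \<gamma>\<^sup>2 * expected_queries \<gamma> p t x) \<le> affinity S (run \<gamma> p t) (run \<gamma> p' t)"
proof (induction t)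
  case (Output z)
  then show ?case
    by (simp add: affinity_refl)
next
  case (Query a b t u)
  have \<gamma>1: "\<gamma> < 1"
    using \<gamma> by simp
  define q q' where "q = answer_prob \<gamma> p a b" and "q' = answer_prob \<gamma> p' a b"
  define X Y where "X = 2 * \<gamma>\<^sup>2 * expected_queries \<gamma> p t x"
    and "Y = 2 * \<gamma>\<^sup>2 * expected_queries \<gamma> p u x"
  have q: "0 < q" "q < 1" "0 < q'" "q' < 1"
    unfolding q_def q'_def using answer_prob_bounds[OF \<gamma>(1) \<gamma>1] by auto
  have "exp (- 2 * \<gamma>\<^sup>2 * expected_queries \<gamma> p (Query a b t u) x)
      = exp (- 2 * \<gamma>\<^sup>2 * of_bool (x = a \<or> x = b) - (q * X + (1 - q) * Y))"
    by (simp add: X_def Y_def q_def algebra_simps)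
  also have "\<dots> \<le> sqrt (q * q') * exp (- X) + sqrt ((1 - q) * (1 - q')) * exp (- Y)"
  \<comment> \<open>If the answer laws agree, the weights are \<open>q\<close> and
    \<open>1 - q\<close> and plain Jensen suffices. Otherwise the order of \<open>a\<close> and
    \<open>b\<close> has been reversed, which forces \<open>x\<close> to be one of them and
    \<open>q' = 1 - q\<close>.\<close>
  proof (cases "q' = q")
    case True
    have "exp (- 2 * \<gamma>\<^sup>2 * of_bool (x = a \<or> x = b) - (q * X + (1 - q) * Y))
        \<le> exp (q * (- X) + (1 - q) * (- Y))"
      by simp
    also have "\<dots> \<le> q * exp (- X) + (1 - q) * exp (- Y)"
      using q by (intro exp_convex_combination) auto
    finally show ?thesis
      using q True by simp
  next
    case False
    then have "x = a \<or> x = b"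
      using same[of a b] unfolding q_def q'_def answer_prob_def by metis
    moreover have q': "q' = 1 - q"
      using False by (auto simp: q_def q'_def answer_prob_def split: if_splits)
    moreover have "q = 1 / 2 + \<gamma> / 2 \<or> q = 1 / 2 - \<gamma> / 2"
      by (simp add: q_def answer_prob_def)
    ultimately show ?thesis
      using affinity_flipped_answer[OF \<gamma>, of q X Y]
      by (simp add: q' mult.commute[of "1 - q" q] distrib_left)
  qed
  also have "\<dots> \<le> sqrt (q * q') * affinity S (run \<gamma> p t) (run \<gamma> p' t) +
      sqrt ((1 - q) * (1 - q')) * affinity S (run \<gamma> p u) (run \<gamma> p' u)"
    using Query.IH q by (intro add_mono mult_left_mono) (auto simp: X_def Y_def)
  also have "\<dots> \<le> affinity S (run \<gamma> p (Query a b t u)) (run \<gamma> p' (Query a b t u))"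
    unfolding q_def q'_def by (rule affinity_run_Query[OF \<gamma>(1) \<gamma>1])
  finally show ?case .
qed

text \<open>Under each root one of the two probabilities is replaced by 1, keeping the one that will
  count as an error. Then \<open>(u + v)\<^sup>2 \<le> 2 * (u\<^sup>2 + v\<^sup>2)\<close>.\<close>

lemma affinity_square_le:
  "(affinity S P Q)\<^sup>2 \<le> 2 * (measure_pmf.prob P (- S) + measure_pmf.prob Q S)"
proof -
  let ?a = "measure_pmf.prob P (- S)" and ?b = "measure_pmf.prob Q S"
  have "affinity S P Q \<le> sqrt ?b + sqrt ?a"
    unfolding affinity_def
    by (intro add_mono real_sqrt_le_mono mult_left_le mult_left_le_one_le) auto
  moreover have "0 \<le> affinity S P Q"
    by (simp add: affinity_def)
  ultimately have "(affinity S P Q)\<^sup>2 \<le> (sqrt ?b + sqrt ?a)\<^sup>2"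
    by (intro power_mono)
  also have "\<dots> \<le> 2 * (?a + ?b)"
    using sum_squares_ge_zero[of "sqrt ?b - sqrt ?a" 0]
    by (simp add: power2_sum algebra_simps)
  finally show ?thesis .
qed

section \<open>Moving one element to the front\<close>

text \<open>It acts on ranks, so composing it after \<open>p\<close> makes the element of rank
  \<open>k\<close> the minimum and leaves the relative order of all others intact.\<close>

definition move_to_front :: "nat \<Rightarrow> nat \<Rightarrow> nat" where
  "move_to_front k j = (if j = k then 0 else if j < k then Suc j else j)"

lemma move_to_front_less_iff:
  "i \<noteq> k \<Longrightarrow> j \<noteq> k \<Longrightarrow> move_to_front k i < move_to_front k j \<longleftrightarrow> i < j"
  by (auto simp: move_to_front_def)

lemma move_to_front_eq_0_iff: "move_to_front k j = 0 \<longleftrightarrow> j = k"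
  by (auto simp: move_to_front_def)

lemma move_to_front_permutes:
  assumes "k < n"
  shows "move_to_front k permutes {..<n}"
proof (rule inj_imp_permutes)
  show "inj_on (move_to_front k) {..<n}"
    by (auto simp: inj_on_def move_to_front_def split: if_splits)
qed (use assms in \<open>auto simp: move_to_front_def\<close>)

definition fail_prob :: "nat \<Rightarrow> real \<Rightarrow> algorithm \<Rightarrow> (nat \<Rightarrow> nat) \<Rightarrow> real" where
  "fail_prob n \<gamma> t p = measure_pmf.prob (run \<gamma> p t) (- {x. is_minimum n p x})"

lemma is_minimum_permutes:
  assumes "p permutes {..<n}" "is_minimum n p x"
  shows "p x = 0"
proof -
  have "0 \<in> p ` {..<n}"
    using assms by (auto simp: permutes_image is_minimum_def)
  then show ?thesis
    using assms(2) by (auto simp: is_minimum_def)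
qed

text \<open>A two-point argument: no output is correct for both orders, while their runs have large
  affinity. The element moved is \<open>inv p k\<close>, and \<open>0 < k\<close> ensures that it
  was not already the minimum.\<close>

lemma fail_prob_add_ge:
  assumes \<gamma>: "0 < \<gamma>" "\<gamma> \<le> 1 / 4" and p: "p permutes {..<n}" and k: "0 < k" "k < n"
  shows "exp (- 4 * \<gamma>\<^sup>2 * expected_queries \<gamma> p t (inv p k)) / 2
    \<le> fail_prob n \<gamma> t p + fail_prob n \<gamma> t (move_to_front k \<circ> p)"
proof -
  let ?p' = "move_to_front k \<circ> p" and ?S = "{x. is_minimum n p x}"
  let ?N = "expected_queries \<gamma> p t (inv p k)"
  have "p a \<noteq> k" if "a \<noteq> inv p k" for a
    using that p by (metis permutes_inverses(2))
  then have same: "p a < p b \<longleftrightarrow> ?p' a < ?p' b" if "a \<noteq> inv p k" "b \<noteq> inv p k" for a b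
    using that by (simp add: move_to_front_less_iff)
  have "?p' permutes {..<n}"
    using p move_to_front_permutes[OF k(2)] by (rule permutes_compose)
  \<comment> \<open>A common minimum would have rank 0 under \<open>p\<close> and rank
    \<open>k\<close> under \<open>p\<close>, against \<open>0 < k\<close>.\<close>
  then have sub: "?S \<subseteq> - {x. is_minimum n ?p' x}"
    using is_minimum_permutes[OF p] is_minimum_permutes k(1)
    by (fastforce simp: move_to_front_eq_0_iff)
  have "exp (- 4 * \<gamma>\<^sup>2 * ?N) = (exp (- 2 * \<gamma>\<^sup>2 * ?N))\<^sup>2"
    by (simp add: power2_eq_square flip: exp_add)
  also have "\<dots> \<le> (affinity ?S (run \<gamma> p t) (run \<gamma> ?p' t))\<^sup>2"
    by (intro power_mono affinity_run_ge[OF \<gamma> same]) auto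
  also have "\<dots> \<le> 2 * (measure_pmf.prob (run \<gamma> p t) (- ?S) + measure_pmf.prob (run \<gamma> ?p' t) ?S)"
    by (rule affinity_square_le)
  also have "\<dots> \<le> 2 * (fail_prob n \<gamma> t p + fail_prob n \<gamma> t ?p')"
    using measure_pmf.finite_measure_mono[OF sub, of "run \<gamma> ?p' t"] by (simp add: fail_prob_def)
  finally show ?thesis
    by simp
qed

section \<open>Averaging over elements and orders\<close>

text \<open>Jensen's inequality with the tangent taken at an upper bound \<open>m\<close> for the
  mean of \<open>y\<close> instead of at the mean itself.\<close>

lemma sum_exp_minus_ge:
  fixes y :: "'a \<Rightarrow> real"
  assumes "(\<Sum>k\<in>K. y k) \<le> real (card K) * m"
  shows "real (card K) * exp (- m) \<le> (\<Sum>k\<in>K. exp (- y k))"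
proof -
  have "exp (- m) * (1 + (m - y k)) \<le> exp (- y k)" for k
    using exp_tangent_le[of "- m" "- y k"] by simp
  then have le: "(\<Sum>k\<in>K. exp (- m) * (1 + (m - y k))) \<le> (\<Sum>k\<in>K. exp (- y k))"
    by (intro sum_mono)
  have "real (card K) * exp (- m)
      \<le> exp (- m) * (real (card K) + (real (card K) * m - (\<Sum>k\<in>K. y k)))"
    unfolding mult.commute[of _ "exp (- m)"] using assms by (intro mult_left_mono) auto
  also have "\<dots> = (\<Sum>k\<in>K. exp (- m) * (1 + (m - y k)))"
    by (simp add: sum.distrib sum_subtractf flip: sum_distrib_left)
  finally show ?thesis
    using le by simp
qed

text \<open>The two-point bound is summed over all orders and all ranks \<open>k\<close> from 1 to
  \<open>n - 1\<close>. Composition with \<open>move_to_front k\<close> permutes the orders, so both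
  failure terms add up to the same sum \<open>?F\<close>.\<close>

lemma sum_fail_prob_ge:
  assumes \<gamma>: "0 < \<gamma>" "\<gamma> \<le> 1 / 4" and n: "2 \<le> n"
    and t: "real (query_complexity t) \<le> c * real n / \<gamma>\<^sup>2"
  shows "fact n * (exp (- 16 * c) / 4) \<le> (\<Sum>p | p permutes {..<n}. fail_prob n \<gamma> t p)"
proof -
  let ?P = "{p. p permutes {..<n}}"
  let ?F = "\<Sum>p\<in>?P. fail_prob n \<gamma> t p"
  let ?N = "\<lambda>p k. expected_queries \<gamma> p t (inv p k)"
  have \<gamma>1: "\<gamma> < 1"
    using \<gamma> by simp
  have D: "\<gamma>\<^sup>2 * real (query_complexity t) \<le> c * real n"
    using t \<gamma> by (simp add: field_simps)
  have "0 \<le> c * real n"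
    using D by (smt (verit) mult_nonneg_nonneg of_nat_0_le_iff zero_le_power2)
  then have c: "0 \<le> c"
    using n by (simp add: zero_le_mult_iff)
  have per_order: "real (n - 1) * exp (- 16 * c) \<le> (\<Sum>k\<in>{1..<n}. exp (- 4 * \<gamma>\<^sup>2 * ?N p k))"
    if p: "p \<in> ?P" for p
  proof -
    have inj: "inj_on (inv p) {1..<n}"
      using p by (metis inj_on_subset mem_Collect_eq permutes_inj permutes_inv subset_UNIV)
    have "(\<Sum>k\<in>{1..<n}. ?N p k) = (\<Sum>x\<in>inv p ` {1..<n}. expected_queries \<gamma> p t x)"
      by (simp only: sum.reindex[OF inj] o_def)
    also have "\<dots> \<le> 2 * real (query_complexity t)"
      by (intro sum_expected_queries_le \<gamma> \<gamma>1) simp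
    finally have "(\<Sum>k\<in>{1..<n}. 4 * \<gamma>\<^sup>2 * ?N p k) \<le> 4 * \<gamma>\<^sup>2 * (2 * real (query_complexity t))"
      unfolding sum_distrib_left[symmetric] by (intro mult_left_mono) auto
    also have "\<dots> \<le> 8 * (c * real n)"
      using D by simp
    \<comment> \<open>Only \<open>n - 1\<close> ranks are available, and
      \<open>n \<le> 2 * (n - 1)\<close> for \<open>n \<ge> 2\<close>; this doubles the constant 8
      to 16.\<close>
    also have "\<dots> \<le> real (card {1..<n}) * (16 * c)"
    proof -
      have "c * real n \<le> c * (2 * real (n - 1))"
        using n c by (intro mult_left_mono) auto
      then show ?thesis
        by (simp add: algebra_simps)
    qed
    finally show ?thesis
      using sum_exp_minus_ge[of "\<lambda>k. 4 * \<gamma>\<^sup>2 * ?N p k" "{1..<n}" "16 * c"] by simp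
  qed
  have shift: "(\<Sum>p\<in>?P. fail_prob n \<gamma> t (move_to_front k \<circ> p)) = ?F" if "k < n" for k
    by (rule setum_permutations_compose_left[OF move_to_front_permutes[OF that], symmetric])
  have "real (n - 1) * (fact n * exp (- 16 * c)) / 2
      = (\<Sum>p\<in>?P. real (n - 1) * exp (- 16 * c)) / 2"
    by (simp add: card_permutations)
  also have "\<dots> \<le> (\<Sum>p\<in>?P. \<Sum>k\<in>{1..<n}. exp (- 4 * \<gamma>\<^sup>2 * ?N p k)) / 2"
    by (intro divide_right_mono sum_mono per_order) auto
  also have "\<dots> = (\<Sum>p\<in>?P. \<Sum>k\<in>{1..<n}. exp (- 4 * \<gamma>\<^sup>2 * ?N p k) / 2)"
    by (simp add: sum_divide_distrib)
  also have "\<dots> \<le> (\<Sum>p\<in>?P. \<Sum>k\<in>{1..<n}.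
      fail_prob n \<gamma> t p + fail_prob n \<gamma> t (move_to_front k \<circ> p))"
    by (intro sum_mono fail_prob_add_ge \<gamma>) auto
  also have "\<dots> = (\<Sum>k\<in>{1..<n}. ?F + (\<Sum>p\<in>?P. fail_prob n \<gamma> t (move_to_front k \<circ> p)))"
    by (subst sum.swap) (simp add: sum.distrib)
  also have "\<dots> = real (n - 1) * (2 * ?F)"
    by (simp add: shift)
  \<comment> \<open>The factor 1/4 combines the 1/2 of the two-point bound with the 2 from counting
    \<open>?F\<close> twice.\<close>
  finally have "real (n - 1) * (fact n * (exp (- 16 * c) / 4)) \<le> real (n - 1) * ?F"
    by simp
  then show ?thesis
    using n by simp
qed

section \<open>Randomized algorithms\<close>

text \<open>The tree is drawn independently of the order, so the two draws can be exchanged. The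
  success probability thus becomes an average over fixed trees.\<close>

lemma findmin_success_eq:
  "findmin_success n \<gamma> A = measure_pmf.expectation A (\<lambda>t.
     1 - (\<Sum>p | p permutes {..<n}. fail_prob n \<gamma> t p) / fact n)"
proof -
  let ?P = "{p. p permutes {..<n}}"
  have fin: "finite ?P" and ne: "?P \<noteq> {}" and card: "card ?P = fact n"
    by (auto simp: finite_permutations card_permutations intro: permutes_id)
  have success: "measure_pmf.prob (bind_pmf (run \<gamma> p t) (\<lambda>x. return_pmf (p, x)))
      {(p, x). is_minimum n p x} = 1 - fail_prob n \<gamma> t p" for p t
    by (simp add: fail_prob_def map_pmf_def[symmetric] vimage_def Compl_eq_Diff_UNIV
        measure_pmf.prob_compl[where 'a = nat, simplified])
  have "measure_pmf.prob (bind_pmf (random_order n) (\<lambda>p.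
        bind_pmf (run \<gamma> p t) (\<lambda>x. return_pmf (p, x)))) {(p, x). is_minimum n p x}
      = 1 - (\<Sum>p\<in>?P. fail_prob n \<gamma> t p) / fact n" for t
    unfolding measure_bind_pmf[of "random_order n"] success
    by (simp add: random_order_def integral_pmf_of_set[OF ne fin] card sum_subtractf
        diff_divide_distrib)
  then show ?thesis
    unfolding findmin_success_def
    by (subst bind_commute_pmf) (simp add: measure_bind_pmf[of A])
qed

theorem theorem13:
  "\<exists>C>0. \<exists>N::nat. \<forall>(c::real) (n::nat) (\<gamma>::real) (A::algorithm pmf).
     c \<ge> 1 \<longrightarrow> n \<ge> N \<longrightarrow> 0 < \<gamma> \<longrightarrow> \<gamma> \<le> 1 / 4 \<longrightarrow>
     query_bounded n (c * real n / \<gamma>\<^sup>2) A \<longrightarrow>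
     findmin_success n \<gamma> A \<le> 1 - exp (- (C * c))"
\<comment> \<open>18 is 16 from the bound for a fixed tree plus 2 to absorb the factor 1/4, as
  \<open>exp (- 2 * c) \<le> 1 / 4\<close> for \<open>c \<ge> 1\<close>. The threshold 2 guarantees
  a rank other than 0.\<close>
proof (intro exI[of _ "18 :: real"] exI[of _ "2 :: nat"] conjI allI impI)
  fix c \<gamma> :: real and n :: nat and A :: "algorithm pmf"
  assume c: "1 \<le> c" and n: "2 \<le> n" and \<gamma>: "0 < \<gamma>" "\<gamma> \<le> 1 / 4"
    and A: "query_bounded n (c * real n / \<gamma>\<^sup>2) A"
  let ?F = "\<lambda>t. (\<Sum>p | p permutes {..<n}. fail_prob n \<gamma> t p) / fact n"
  have "exp (- 2 * c) \<le> 1 / (4 :: real)"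
  proof -
    have "exp (- 2 * c) = (exp (- c))\<^sup>2"
      by (simp add: power2_eq_square flip: exp_add)
    moreover have "2 \<le> exp c"
      using exp_ge_add_one_self[of c] c by linarith
    then have "exp (- c) \<le> 1 / 2"
      by (simp add: exp_minus field_simps)
    ultimately show ?thesis
      using power_mono[of "exp (- c)" "1 / 2" 2] by (simp add: power2_eq_square)
  qed
  then have "exp (- 16 * c) * exp (- 2 * c) \<le> exp (- 16 * c) * (1 / 4)"
    by (intro mult_left_mono) auto
  then have C: "exp (- (18 * c)) \<le> exp (- 16 * c) / 4"
    by (simp flip: exp_add)
  have F: "?F t \<in> {exp (- (18 * c))..}" if "t \<in> set_pmf A" for t
  proof -
    have "real (query_complexity t) \<le> c * real n / \<gamma>\<^sup>2"
      using A that by (auto simp: query_bounded_def)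
    from sum_fail_prob_ge[OF \<gamma> n this] have "exp (- 16 * c) / 4 \<le> ?F t"
      by (simp add: field_simps)
    with C show ?thesis
      unfolding atLeast_iff by (rule order_trans)
  qed
  have F0: "0 \<le> ?F t" for t
    by (intro divide_nonneg_nonneg sum_nonneg) (auto simp: fail_prob_def)
  have "?F t \<le> (\<Sum>p | p permutes {..<n}. 1) / fact n" for t
    by (intro divide_right_mono sum_mono) (auto simp: fail_prob_def)
  then have F1: "?F t \<le> 1" for t
    by (simp add: card_permutations)
  have "findmin_success n \<gamma> A = measure_pmf.expectation A (\<lambda>t. 1 - ?F t)"
    by (rule findmin_success_eq)
  \<comment> \<open>The bound holds for every tree in the support, hence for the average;
    \<open>F0\<close> and \<open>F1\<close> give integrability.\<close>
  also have "\<dots> \<le> 1 - exp (- (18 * c))"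
    using F F0 F1
    by (intro measure_pmf.integral_le_const measure_pmf.integrable_const_bound[where B = 1])
      (auto simp: AE_measure_pmf_iff)
  finally show "findmin_success n \<gamma> A \<le> 1 - exp (- (18 * c))" .
qed simp

end
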